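(* Let $\mathbf k$ be a field of characteristic $0$, $\lambda\in\mathbf k$, let $(\mathfrak g,d_{\mathfrak g})$ be a differential Lie algebra of weight $\lambda$ and $(V,\rho,d_V)$ a representation of it. Then the cochain complex $(\mathrm C^*_{\mathrm{DL}_\lambda}(\mathfrak g,V),\partial^*_{\mathrm{DL}_\lambda})$ is a subcomplex of $(\mathrm C^*_{\mathrm{DL}_\lambda}(\mathfrak g\ltimes V,(\mathfrak g\ltimes V)_{\mathrm{ad}}),\partial^*_{\mathrm{DL}_\lambda})$, via the natural injections induced by $\mathrm{Hom}(\wedge^n\mathfrak g,V)\hookrightarrow\mathrm{Hom}(\wedge^n(\mathfrak g\oplus V),\mathfrak g\oplus V)$ (compose with the projection $\wedge^n(\mathfrak g\oplus V)\to\wedge^n\mathfrak g$ and the inclusion $V\subset\mathfrak g\oplus V$).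
   Context: A differential Lie algebra of weight $\lambda$ is a Lie algebra $\mathfrak g$ with a linear map $d_{\mathfrak g}$ such that $d_{\mathfrak g}([x,y])=[d_{\mathfrak g}(x),y]+[x,d_{\mathfrak g}(y)]+\lambda[d_{\mathfrak g}(x),d_{\mathfrak g}(y)]$. A representation is $(V,\rho,d_V)$ with $(V,\rho)$ a representation of the Lie algebra $\mathfrak g$ and $d_V(\rho(x)v)=\rho(d_{\mathfrak g}(x))v+\rho(x)d_V(v)+\lambda\rho(d_{\mathfrak g}(x))d_V(v)$. The adjoint representation $\mathfrak g_{\mathrm{ad}}$ is $V=\mathfrak g$, $\rho(x)=[x,-]$, $d_V=d_{\mathfrak g}$. The trivial extension $\mathfrak g\ltimes V$ is the differential Lie algebra $\mathfrak g\oplus V$ with bracket $\{x+u,y+v\}=[x,y]+\rho(x)v-\rho(y)u$ and operator $d_{\mathfrak g}+d_V$. Put $\rho_\lambda(x)=\rho(x+\lambda d_{\mathfrak g}(x))$. For $f\in\mathrm{Hom}(\wedge^n\mathfrak g,V)$, $n\ge0$, $$\partial^n_{\mathrm{Lie}}(f)(x_1,\dots,x_{n+1})=\sum_{i}(-1)^{i+n}\rho(x_i)f(x_1,\dots,\hat x_i,\dots,x_{n+1})+\sum_{i<j}(-1)^{i+j+n+1}f([x_i,x_j],x_1,\dots,\hat x_i,\dots,\hat x_j,\dots,x_{n+1}),$$ $\partial^n_{\mathrm{DO}_\lambda}$ is the same with $\rho_\lambda$ in place of $\rho$, and $$\delta^nf(x_1,\dots,x_n)=\sum_{k=1}^n\lambda^{k-1}\sum_{i_1<\dots<i_k}f(x_1,\dots,d_{\mathfrak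 g}(x_{i_1}),\dots,d_{\mathfrak g}(x_{i_k}),\dots,x_n)-d_Vf(x_1,\dots,x_n)$$ for $n\ge1$, $\delta^0v=-d_V(v)$. The complex is $\mathrm C^0_{\mathrm{DL}_\lambda}(\mathfrak g,V)=V$, $\mathrm C^n_{\mathrm{DL}_\lambda}(\mathfrak g,V)=\mathrm{Hom}(\wedge^n\mathfrak g,V)\oplus\mathrm{Hom}(\wedge^{n-1}\mathfrak g,V)$ for $n\ge1$, with $\partial^n_{\mathrm{DL}_\lambda}(f,g)=(\partial^n_{\mathrm{Lie}}f,-\partial^{n-1}_{\mathrm{DO}_\lambda}g-\delta^nf)$ for $n\ge1$ and $\partial^0_{\mathrm{DL}_\lambda}v=(\partial^0_{\mathrm{Lie}}v,-\delta^0v)$. *)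

theory Defs
  imports "HOL-Analysis.Product_Vector" "HOL-Library.Function_Algebras"
begin

text \<open>A vector space over the field \<open>'k\<close> is a type of class \<open>ab_group_add\<close> with an explicit
  scalar multiplication, as in the locale \<^locale>\<open>vector_space\<close>. The direct sum
  of two spaces is the product type, with scalar multiplication \<^const>\<open>module_prod.scale\<close>.\<close>

subsection \<open>Differential Lie algebras and their representations\<close>

locale lie_algebra = vector_space scale
  for scale :: "'k::field \<Rightarrow> 'g::ab_group_add \<Rightarrow> 'g" +
  fixes bracket :: "'g \<Rightarrow> 'g \<Rightarrow> 'g"
  assumes bracket_linear_left: "Vector_Spaces.linear scale scale (\<lambda>x. bracket x y)"
    and bracket_linear_right: "Vector_Spaces.linear scale scale (\<lambda>y. bracket x y)"
    and bracket_self: "bracket x x = 0"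
    and jacobi: "bracket x (bracket y z) + bracket y (bracket z x) + bracket z (bracket x y) = 0"

locale diff_lie_algebra = lie_algebra scale bracket
  for scale :: "'k::field \<Rightarrow> 'g::ab_group_add \<Rightarrow> 'g" and bracket :: "'g \<Rightarrow> 'g \<Rightarrow> 'g" +
  fixes lam :: 'k and d :: "'g \<Rightarrow> 'g"
  assumes d_linear: "Vector_Spaces.linear scale scale d"
    and d_bracket: "d (bracket x y)
      = bracket (d x) y + bracket x (d y) + scale lam (bracket (d x) (d y))"

locale lie_rep = lie_algebra scale bracket + V: vector_space scaleV
  for scale :: "'k::field \<Rightarrow> 'g::ab_group_add \<Rightarrow> 'g" and bracket :: "'g \<Rightarrow> 'g \<Rightarrow> 'g"
    and scaleV :: "'k \<Rightarrow> 'v::ab_group_add \<Rightarrow> 'v" +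
  fixes \<rho> :: "'g \<Rightarrow> 'v \<Rightarrow> 'v"
  assumes rho_linear_left: "Vector_Spaces.linear scale scaleV (\<lambda>x. \<rho> x v)"
    and rho_linear_right: "Vector_Spaces.linear scaleV scaleV (\<rho> x)"
    and rho_bracket: "\<rho> (bracket x y) v = \<rho> x (\<rho> y v) - \<rho> y (\<rho> x v)"

locale diff_lie_rep = diff_lie_algebra scale bracket lam d + lie_rep scale bracket scaleV \<rho>
  for scale :: "'k::field \<Rightarrow> 'g::ab_group_add \<Rightarrow> 'g" and bracket :: "'g \<Rightarrow> 'g \<Rightarrow> 'g"
    and lam :: 'k and d :: "'g \<Rightarrow> 'g"
    and scaleV :: "'k \<Rightarrow> 'v::ab_group_add \<Rightarrow> 'v" and \<rho> :: "'g \<Rightarrow> 'v \<Rightarrow> 'v" +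
  fixes dV :: "'v \<Rightarrow> 'v"
  assumes dV_linear: "Vector_Spaces.linear scaleV scaleV dV"
    and dV_rho: "dV (\<rho> x v) = \<rho> (d x) v + \<rho> x (dV v) + scaleV lam (\<rho> (d x) (dV v))"

text \<open>The adjoint representation is the bracket itself, read as the map sending \<open>x\<close> to
  \<open>bracket x\<close>, with operator \<open>d\<close>.\<close>

lemma (in diff_lie_algebra) adjoint_diff_lie_rep:
  "diff_lie_rep scale bracket lam d scale bracket d"
proof -
  interpret l: Vector_Spaces.linear scale scale "\<lambda>x. bracket x y" for y
    by (rule bracket_linear_left)
  interpret r: Vector_Spaces.linear scale scale "\<lambda>y. bracket x y" for x
    by (rule bracket_linear_right)
  interpret dg: Vector_Spaces.linear scale scale d by (rule d_linear)
  have anti: "bracket a b = - bracket b a" for a b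
  proof -
    have "bracket (a + b) (a + b) = bracket a a + bracket b a + (bracket a b + bracket b b)"
      by (simp only: l.add r.add)
    then have "bracket a b + bracket b a = 0"
      by (simp add: bracket_self add.commute)
    then show ?thesis by (simp add: eq_neg_iff_add_eq_0)
  qed
  have rep: "bracket (bracket x y) v = bracket x (bracket y v) - bracket y (bracket x v)" for x y v
  proof -
    have e1: "bracket y (bracket v x) = - bracket y (bracket x v)"
      by (subst anti[of v x]) (rule r.neg)
    have e2: "bracket v (bracket x y) = - bracket (bracket x y) v"
      by (rule anti)
    show ?thesis
      using jacobi[of x y v] unfolding e1 e2 by simp
  qed
  show ?thesis
  proof unfold_locales
    show "bracket (bracket x y) v = bracket x (bracket y v) - bracket y (bracket x v)" for x y v
      by (rule rep)
  qed (simp_all add: d_bracket dg.add dg.scale l.add r.add l.scale r.scale)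
qed

text \<open>The trivial extension of a differential Lie algebra by a representation.\<close>

definition ext_bracket ::
    "('g \<Rightarrow> 'g \<Rightarrow> 'g) \<Rightarrow> ('g \<Rightarrow> 'v \<Rightarrow> 'v::ab_group_add) \<Rightarrow> 'g \<times> 'v \<Rightarrow> 'g \<times> 'v \<Rightarrow> 'g \<times> 'v" where
  "ext_bracket bracket \<rho> = (\<lambda>(x, u) (y, v). (bracket x y, \<rho> x v - \<rho> y u))"

definition ext_d :: "('g \<Rightarrow> 'g) \<Rightarrow> ('v \<Rightarrow> 'v) \<Rightarrow> 'g \<times> 'v \<Rightarrow> 'g \<times> 'v" where
  "ext_d d dV = (\<lambda>(x, u). (d x, dV u))"

lemma (in diff_lie_rep) ext_diff_lie_algebra:
  "diff_lie_algebra (module_prod.scale scale scaleV) (ext_bracket bracket \<rho>) lam (ext_d d dV)"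
proof -
  interpret P: vector_space_prod scale scaleV by unfold_locales
  interpret bl: Vector_Spaces.linear scale scale "\<lambda>x. bracket x y" for y
    by (rule bracket_linear_left)
  interpret br: Vector_Spaces.linear scale scale "\<lambda>y. bracket x y" for x
    by (rule bracket_linear_right)
  interpret rl: Vector_Spaces.linear scale scaleV "\<lambda>x. \<rho> x v" for v
    by (rule rho_linear_left)
  interpret rr: Vector_Spaces.linear scaleV scaleV "\<rho> x" for x
    by (rule rho_linear_right)
  interpret dg: Vector_Spaces.linear scale scale d by (rule d_linear)
  interpret dv: Vector_Spaces.linear scaleV scaleV dV by (rule dV_linear)
  show ?thesis
  proof unfold_locales
    show "ext_bracket bracket \<rho> x (ext_bracket bracket \<rho> y z)
        + ext_bracket bracket \<rho> y (ext_bracket bracket \<rho> z x)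
        + ext_bracket bracket \<rho> z (ext_bracket bracket \<rho> x y) = 0" for x y z
      by (simp add: ext_bracket_def split_beta prod_eq_iff rho_bracket rr.diff
          algebra_simps jacobi[unfolded add.assoc])
    show "ext_d d dV (ext_bracket bracket \<rho> x y)
        = ext_bracket bracket \<rho> (ext_d d dV x) y + ext_bracket bracket \<rho> x (ext_d d dV y)
          + P.scale lam (ext_bracket bracket \<rho> (ext_d d dV x) (ext_d d dV y))" for x y
      by (simp add: ext_bracket_def ext_d_def P.scale_def split_beta prod_eq_iff
          d_bracket dV_rho dv.diff V.scale_right_diff_distrib algebra_simps)
  qed (simp_all add: ext_bracket_def ext_d_def P.scale_def split_beta prod_eq_iff bracket_self
      bl.add br.add rl.add rr.add dg.add dv.add bl.scale br.scale rl.scale rr.scale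
      dg.scale dv.scale V.scale_right_diff_distrib algebra_simps)
qed

subsection \<open>Cochains\<close>

text \<open>\<open>Hom(\<Lambda>\<^sup>n A, B)\<close> is the space of alternating multilinear maps in \<open>n\<close> arguments from \<open>A\<close> to
  \<open>B\<close>. The argument tuple is a list of length \<open>n\<close>; the maps vanish on lists of other lengths,
  so that equality of cochains is equality of functions.\<close>

definition alt_maps ::
    "('k::field \<Rightarrow> 'a::ab_group_add \<Rightarrow> 'a) \<Rightarrow> ('k \<Rightarrow> 'b::ab_group_add \<Rightarrow> 'b) \<Rightarrow> nat
      \<Rightarrow> ('a list \<Rightarrow> 'b) set" where
  "alt_maps sA sB n = {f.
     (\<forall>xs. length xs \<noteq> n \<longrightarrow> f xs = 0) \<and>
     (\<forall>xs i. length xs = n \<longrightarrow> i < n \<longrightarrow> Vector_Spaces.linear sA sB (\<lambda>x. f (xs[i := x]))) \<and>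
     (\<forall>xs i j. length xs = n \<longrightarrow> i < j \<longrightarrow> j < n \<longrightarrow> xs ! i = xs ! j \<longrightarrow> f xs = 0)}"

lemma alt_maps_0: "bij_betw (\<lambda>f. f []) (alt_maps sA sB 0) UNIV"
proof (rule bij_betwI')
  fix f g assume fg: "f \<in> alt_maps sA sB 0" "g \<in> alt_maps sA sB 0"
  show "(f [] = g []) = (f = g)"
  proof
    assume "f [] = g []"
    with fg have "f xs = g xs" for xs by (cases xs) (auto simp: alt_maps_def)
    then show "f = g" by blast
  qed simp
next
  fix v
  have "(\<lambda>xs. if xs = [] then v else 0) \<in> alt_maps sA sB 0" by (simp add: alt_maps_def)
  then show "\<exists>f\<in>alt_maps sA sB 0. v = f []" by (rule bexI[rotated]) simp
qed auto

text \<open>\<open>CE_diff sV bracket \<rho> n\<close> is the differential of Lie algebra cohomology on cochains of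
  degree \<open>n\<close>. List positions count from \<open>0\<close>: the argument \<open>x\<^sub>i\<close> is \<open>xs ! (i - 1)\<close>, so
  \<open>(-1)\<^bsup>i+n\<^esup>\<close> becomes \<open>(-1)^(Suc i + n)\<close>, and similarly for the second sum.\<close>

definition CE_diff ::
    "('k::field \<Rightarrow> 'v::ab_group_add \<Rightarrow> 'v) \<Rightarrow> ('g \<Rightarrow> 'g \<Rightarrow> 'g) \<Rightarrow> ('g \<Rightarrow> 'v \<Rightarrow> 'v) \<Rightarrow> nat
      \<Rightarrow> ('g list \<Rightarrow> 'v) \<Rightarrow> 'g list \<Rightarrow> 'v" where
  "CE_diff sV bracket \<rho> n f xs =
     (if length xs = Suc n
      then (\<Sum>i<Suc n. sV ((-1) ^ (Suc i + n)) (\<rho> (xs ! i) (f (nths xs (- {i})))))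
         + (\<Sum>j<Suc n. \<Sum>i<j. sV ((-1) ^ (Suc i + Suc j + n + 1))
             (f (bracket (xs ! i) (xs ! j) # nths xs (- {i, j}))))
      else 0)"

text \<open>\<open>rho_twist\<close> is \<open>\<rho>\<^sub>\<lambda>\<close>; the differential for the operator is \<open>CE_diff\<close> with \<open>\<rho>\<^sub>\<lambda>\<close> in place
  of \<open>\<rho>\<close>.\<close>

definition rho_twist ::
    "('k \<Rightarrow> 'g::ab_group_add \<Rightarrow> 'g) \<Rightarrow> 'k \<Rightarrow> ('g \<Rightarrow> 'g) \<Rightarrow> ('g \<Rightarrow> 'v \<Rightarrow> 'v) \<Rightarrow> 'g \<Rightarrow> 'v \<Rightarrow> 'v" where
  "rho_twist sG lam d \<rho> x = \<rho> (x + sG lam (d x))"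

definition apply_at :: "('g \<Rightarrow> 'g) \<Rightarrow> nat set \<Rightarrow> 'g list \<Rightarrow> 'g list" where
  "apply_at d I xs = map (\<lambda>i. if i \<in> I then d (xs ! i) else xs ! i) [0..<length xs]"

text \<open>For \<open>n = 0\<close> the sum is empty, so that \<open>diff_delta\<close> is the map sending \<open>v\<close> to \<open>- dV v\<close>.\<close>

definition diff_delta ::
    "('k::field \<Rightarrow> 'v::ab_group_add \<Rightarrow> 'v) \<Rightarrow> 'k \<Rightarrow> ('g \<Rightarrow> 'g) \<Rightarrow> ('v \<Rightarrow> 'v) \<Rightarrow> nat
      \<Rightarrow> ('g list \<Rightarrow> 'v) \<Rightarrow> 'g list \<Rightarrow> 'v" where
  "diff_delta sV lam d dV n f xs =
     (if length xs = n
      then (\<Sum>k = 1..n. sV (lam ^ (k - 1)) (\<Sum>I | I \<subseteq> {..<n} \<and> card I = k. f (apply_at d I xs)))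
         - dV (f xs)
      else 0)"

text \<open>All degrees of the complex live in one type of pairs. In degree \<open>0\<close> the second component is
  \<open>0\<close>, and the first is an alternating map in no arguments, that is, an element of \<open>V\<close>
  (see \<open>alt_maps_0\<close>).\<close>

definition DL_cochains ::
    "('k::field \<Rightarrow> 'g::ab_group_add \<Rightarrow> 'g) \<Rightarrow> ('k \<Rightarrow> 'v::ab_group_add \<Rightarrow> 'v) \<Rightarrow> nat
      \<Rightarrow> (('g list \<Rightarrow> 'v) \<times> ('g list \<Rightarrow> 'v)) set" where
  "DL_cochains sG sV n =
     alt_maps sG sV n \<times> (case n of 0 \<Rightarrow> {0} | Suc m \<Rightarrow> alt_maps sG sV m)"

definition DL_scale ::
    "('k \<Rightarrow> 'v \<Rightarrow> 'v) \<Rightarrow> 'k \<Rightarrow> ('g list \<Rightarrow> 'v) \<times> ('g list \<Rightarrow> 'v)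
      \<Rightarrow> ('g list \<Rightarrow> 'v) \<times> ('g list \<Rightarrow> 'v)" where
  "DL_scale sV a = (\<lambda>(f, g). (\<lambda>xs. sV a (f xs), \<lambda>xs. sV a (g xs)))"

definition DL_diff ::
    "('k::field \<Rightarrow> 'g::ab_group_add \<Rightarrow> 'g) \<Rightarrow> ('g \<Rightarrow> 'g \<Rightarrow> 'g) \<Rightarrow> 'k \<Rightarrow> ('g \<Rightarrow> 'g)
      \<Rightarrow> ('k \<Rightarrow> 'v::ab_group_add \<Rightarrow> 'v) \<Rightarrow> ('g \<Rightarrow> 'v \<Rightarrow> 'v) \<Rightarrow> ('v \<Rightarrow> 'v) \<Rightarrow> nat
      \<Rightarrow> ('g list \<Rightarrow> 'v) \<times> ('g list \<Rightarrow> 'v) \<Rightarrow> ('g list \<Rightarrow> 'v) \<times> ('g list \<Rightarrow> 'v)" where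
  "DL_diff sG bracket lam d sV \<rho> dV n = (\<lambda>(f, g).
     (CE_diff sV bracket \<rho> n f,
      (case n of 0 \<Rightarrow> 0 | Suc m \<Rightarrow> - CE_diff sV bracket (rho_twist sG lam d \<rho>) m g)
        - diff_delta sV lam d dV n f))"

subsection \<open>Cochain complexes and subcomplexes\<close>

definition linear_on_subspace ::
    "'c set \<Rightarrow> ('k \<Rightarrow> 'c::ab_group_add \<Rightarrow> 'c) \<Rightarrow> ('k \<Rightarrow> 'e::ab_group_add \<Rightarrow> 'e)
      \<Rightarrow> ('c \<Rightarrow> 'e) \<Rightarrow> bool" where
  "linear_on_subspace S sC sE f \<longleftrightarrow>
     (\<forall>x\<in>S. \<forall>y\<in>S. f (x + y) = f x + f y) \<and> (\<forall>a. \<forall>x\<in>S. f (sC a x) = sE a (f x))"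

text \<open>A cochain complex of subspaces \<open>C n\<close> of one ambient vector space; \<open>D n\<close> matters only on
  \<open>C n\<close>.\<close>

definition cochain_complex ::
    "('k::field \<Rightarrow> 'c::ab_group_add \<Rightarrow> 'c) \<Rightarrow> (nat \<Rightarrow> 'c set) \<Rightarrow> (nat \<Rightarrow> 'c \<Rightarrow> 'c) \<Rightarrow> bool" where
  "cochain_complex s C D \<longleftrightarrow> vector_space s \<and>
     (\<forall>n. module.subspace s (C n) \<and> D n ` C n \<subseteq> C (Suc n) \<and> linear_on_subspace (C n) s s (D n) \<and>
          (\<forall>c\<in>C n. D (Suc n) (D n c) = 0))"

definition subcomplex_via ::
    "(nat \<Rightarrow> 'c \<Rightarrow> 'e)
      \<Rightarrow> ('k::field \<Rightarrow> 'c::ab_group_add \<Rightarrow> 'c) \<Rightarrow> (nat \<Rightarrow> 'c set) \<Rightarrow> (nat \<Rightarrow> 'c \<Rightarrow> 'c)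
      \<Rightarrow> ('k \<Rightarrow> 'e::ab_group_add \<Rightarrow> 'e) \<Rightarrow> (nat \<Rightarrow> 'e set) \<Rightarrow> (nat \<Rightarrow> 'e \<Rightarrow> 'e) \<Rightarrow> bool" where
  "subcomplex_via \<iota> s C D s' C' D' \<longleftrightarrow>
     cochain_complex s C D \<and> cochain_complex s' C' D' \<and>
     (\<forall>n. \<iota> n ` C n \<subseteq> C' n \<and> linear_on_subspace (C n) s s' (\<iota> n) \<and> inj_on (\<iota> n) (C n) \<and>
          (\<forall>c\<in>C n. D' n (\<iota> n c) = \<iota> (Suc n) (D n c)))"

subsection \<open>The natural injections\<close>

definition hom_inj :: "('g list \<Rightarrow> 'v) \<Rightarrow> ('g \<times> 'v) list \<Rightarrow> 'g::zero \<times> 'v" where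
  "hom_inj f zs = (0, f (map fst zs))"

definition DL_inj ::
    "nat \<Rightarrow> ('g list \<Rightarrow> 'v) \<times> ('g list \<Rightarrow> 'v)
      \<Rightarrow> (('g \<times> 'v) list \<Rightarrow> 'g::zero \<times> 'v) \<times> (('g \<times> 'v) list \<Rightarrow> 'g \<times> 'v)" where
  "DL_inj n = map_prod hom_inj hom_inj"

end

theory Submission
  imports Defs
begin

text \<open>Up to the sign \<open>(-1)\<^bsup>n+1\<^esup>\<close> the Chevalley--Eilenberg differential satisfies Cartan's formula, so on
  lists of arguments it can be defined by recursion from the Lie derivative; \<open>\<partial>\<partial> = 0\<close> then reduces to
  \<open>[L\<^sub>x, L\<^sub>y] = L\<^bsub>[x,y]\<^esub>\<close> and \<open>L\<^sub>x \<partial> = \<partial> L\<^sub>x\<close>, each an induction on the list. The identity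
  \<open>\<delta> \<partial>\<^bsub>Lie\<^esub> = \<partial>\<^bsub>DO\<^esub> \<delta>\<close> comes from adjoining \<open>\<epsilon>\<close> with \<open>\<epsilon>\<^sup>2 = \<lambda> \<epsilon>\<close>: both the pullback along
  \<open>1 + \<epsilon> d\<close> and the composition with \<open>1 + \<epsilon> d\<^sub>V\<close> are chain maps into the complex of the
  representation \<open>\<rho> \<circ> (1 + \<epsilon> d)\<close>, and \<open>\<delta>\<close> is the \<open>\<epsilon>\<close>-coefficient of their difference. Finally,
  the injections commute with all differentials because in \<open>\<gg> \<ltimes> V\<close> the bracket with an element of
  \<open>V\<close> only involves the \<open>\<gg>\<close>-component.\<close>

subsection \<open>Alternating multilinear maps on lists\<close>

text \<open>The slot is marked by splitting the list and no length is fixed, so that the contraction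
  \<open>f (x # _)\<close> is again multilinear and inductions on lists need no bookkeeping of
  degrees.\<close>

definition multilinear ::
    "('k \<Rightarrow> 'a::ab_group_add \<Rightarrow> 'a) \<Rightarrow> ('k \<Rightarrow> 'b::ab_group_add \<Rightarrow> 'b) \<Rightarrow> ('a list \<Rightarrow> 'b) \<Rightarrow> bool" where
  "multilinear sA sB f \<longleftrightarrow>
     (\<forall>ys a b zs. f (ys @ (a + b) # zs) = f (ys @ a # zs) + f (ys @ b # zs)) \<and>
     (\<forall>ys c a zs. f (ys @ sA c a # zs) = sB c (f (ys @ a # zs)))"

text \<open>Neighbouring entries suffice for the inductions on lists;
  \<open>adj_alternating_distant\<close> recovers arbitrary positions.\<close>

definition adj_alternating :: "('a list \<Rightarrow> 'b::zero) \<Rightarrow> bool" where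
  "adj_alternating f \<longleftrightarrow> (\<forall>ys a zs. f (ys @ a # a # zs) = 0)"

lemma multilinearI:
  assumes "\<And>ys a b zs. f (ys @ (a + b) # zs) = f (ys @ a # zs) + f (ys @ b # zs)"
    and "\<And>ys c a zs. f (ys @ sA c a # zs) = sB c (f (ys @ a # zs))"
  shows "multilinear sA sB f"
  using assms by (simp add: multilinear_def)

lemma multilinear_add:
  "multilinear sA sB f \<Longrightarrow> f (ys @ (a + b) # zs) = f (ys @ a # zs) + f (ys @ b # zs)"
  by (simp add: multilinear_def)

lemma multilinear_scale: "multilinear sA sB f \<Longrightarrow> f (ys @ sA c a # zs) = sB c (f (ys @ a # zs))"
  by (simp add: multilinear_def)

lemma multilinear_Cons_add: "multilinear sA sB f \<Longrightarrow> f ((a + b) # zs) = f (a # zs) + f (b # zs)"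
  using multilinear_add[of sA sB f "[]"] by simp

lemma multilinear_Cons_scale: "multilinear sA sB f \<Longrightarrow> f (sA c a # zs) = sB c (f (a # zs))"
  using multilinear_scale[of sA sB f "[]"] by simp

lemma multilinear_Cons_diff: "multilinear sA sB f \<Longrightarrow> f ((a - b) # zs) = f (a # zs) - f (b # zs)"
  using multilinear_Cons_add[of sA sB f "a - b" b zs] by simp

lemma multilinear_contract:
  assumes "multilinear sA sB f"
  shows "multilinear sA sB (\<lambda>ys. f (x # ys))"
proof (rule multilinearI)
  show "f (x # ys @ (a + b) # zs) = f (x # ys @ a # zs) + f (x # ys @ b # zs)" for ys a b zs
    using multilinear_add[OF assms, of "x # ys"] by simp
  show "f (x # ys @ sA c a # zs) = sB c (f (x # ys @ a # zs))" for ys c a zs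
    using multilinear_scale[OF assms, of "x # ys"] by simp
qed

lemma adj_alternatingD: "adj_alternating f \<Longrightarrow> f (ys @ a # a # zs) = 0"
  by (simp add: adj_alternating_def)

lemma adj_alternating_Cons: "adj_alternating f \<Longrightarrow> f (a # a # zs) = 0"
  using adj_alternatingD[of f "[]"] by simp

lemma adj_alternating_contract:
  assumes "adj_alternating f"
  shows "adj_alternating (\<lambda>ys. f (x # ys))"
  unfolding adj_alternating_def using adj_alternatingD[OF assms, of "x # ys" for ys] by simp

lemma adj_alternating_swap:
  assumes "multilinear sA sB f" and "adj_alternating f"
  shows "f (ys @ a # b # zs) = - f (ys @ b # a # zs)"
proof -
  note add = multilinear_add[OF assms(1)]
  have "0 = f (ys @ (a + b) # (a + b) # zs)"
    by (simp add: adj_alternatingD[OF assms(2)])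
  also have "\<dots> = f (ys @ a # (a + b) # zs) + f (ys @ b # (a + b) # zs)"
    by (rule add)
  also have "f (ys @ a # (a + b) # zs) = f (ys @ a # b # zs)"
    using add[of "ys @ [a]" a b zs] by (simp add: adj_alternatingD[OF assms(2)])
  also have "f (ys @ b # (a + b) # zs) = f (ys @ b # a # zs)"
    using add[of "ys @ [b]" a b zs] by (simp add: adj_alternatingD[OF assms(2)])
  finally show ?thesis by (simp only: eq_neg_iff_add_eq_0)
qed

lemma adj_alternating_Cons_swap:
  assumes "multilinear sA sB f" and "adj_alternating f"
  shows "f (a # b # zs) = - f (b # a # zs)"
  using adj_alternating_swap[OF assms, of "[]" a b zs] by simp

text \<open>The left copy of \<open>a\<close> is swapped past \<open>ms\<close>, one entry at a
  time, until it meets the other copy.\<close>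

lemma adj_alternating_distant:
  assumes "multilinear sA sB f" and "adj_alternating f"
  shows "f (ys @ a # ms @ a # zs) = 0"
proof (induction ms arbitrary: ys)
  case Nil
  show ?case by (simp add: adj_alternatingD[OF assms(2)])
next
  case (Cons m ms)
  then show ?case
    using Cons.IH[of "ys @ [m]"] adj_alternating_swap[OF assms, of ys a m] by simp
qed

text \<open>Conditions that ignore lengths can replace those of \<open>alt_maps\<close>, because on
  lists of the wrong length \<open>f\<close> vanishes and they hold trivially.\<close>

lemma mem_alt_maps_iff:
  assumes "vector_space sA" and "vector_space sB"
  shows "f \<in> alt_maps sA sB n \<longleftrightarrow>
    (\<forall>xs. length xs \<noteq> n \<longrightarrow> f xs = 0) \<and> multilinear sA sB f \<and> adj_alternating f"
proof (intro iffI conjI)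
  interpret A: vector_space sA by fact
  interpret B: vector_space sB by fact
  assume f: "f \<in> alt_maps sA sB n"
  then show z: "\<forall>xs. length xs \<noteq> n \<longrightarrow> f xs = 0" by (simp add: alt_maps_def)
  have lin: "Vector_Spaces.linear sA sB (\<lambda>x. f (ys @ x # zs))"
    if "length ys + Suc (length zs) = n" for ys zs
  proof -
    \<comment> \<open>The entry 0 only reserves the slot that the update overwrites.\<close>
    have "length (ys @ 0 # zs) = n" "length ys < n" using that by auto
    then have "Vector_Spaces.linear sA sB (\<lambda>x. f ((ys @ 0 # zs)[length ys := x]))"
      using f unfolding alt_maps_def by blast
    then show ?thesis by simp
  qed
  show "multilinear sA sB f"
  proof (rule multilinearI)
    show "f (ys @ (a + b) # zs) = f (ys @ a # zs) + f (ys @ b # zs)" for ys a b zs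
    proof (cases "length ys + Suc (length zs) = n")
      case True
      interpret l: Vector_Spaces.linear sA sB "\<lambda>x. f (ys @ x # zs)" by (rule lin[OF True])
      show ?thesis by (rule l.add)
    qed (use z in auto)
    show "f (ys @ sA c a # zs) = sB c (f (ys @ a # zs))" for ys c a zs
    proof (cases "length ys + Suc (length zs) = n")
      case True
      interpret l: Vector_Spaces.linear sA sB "\<lambda>x. f (ys @ x # zs)" by (rule lin[OF True])
      show ?thesis by (rule l.scale)
    qed (use z in auto)
  qed
  show "adj_alternating f"
    unfolding adj_alternating_def
  proof (intro allI)
    fix ys a zs
    show "f (ys @ a # a # zs) = 0"
    proof (cases "length (ys @ a # a # zs) = n")
      case True
      moreover have "(ys @ a # a # zs) ! length ys = (ys @ a # a # zs) ! Suc (length ys)"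
        by (simp add: nth_append)
      moreover have "Suc (length ys) < n" using True by simp
      ultimately show ?thesis
        using f unfolding alt_maps_def by blast
    qed (use z in auto)
  qed
next
  interpret A: vector_space sA by fact
  interpret B: vector_space sB by fact
  assume r: "(\<forall>xs. length xs \<noteq> n \<longrightarrow> f xs = 0) \<and> multilinear sA sB f \<and> adj_alternating f"
  then have m: "multilinear sA sB f" and a: "adj_alternating f" by auto
  have "Vector_Spaces.linear sA sB (\<lambda>x. f (xs[i := x]))" if "i < length xs" for xs i
    unfolding upd_conv_take_nth_drop[OF that]
    by unfold_locales (simp_all add: multilinear_add[OF m] multilinear_scale[OF m])
  moreover have "f xs = 0" if "i < j" "j < length xs" "xs ! i = xs ! j" for xs i j
  proof -
    have ys: "drop (Suc i) xs ! (j - Suc i) = xs ! j" "j - Suc i < length (drop (Suc i) xs)"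
      using that by auto
    have "xs = take i xs @ xs ! i # drop (Suc i) xs"
      using that by (intro id_take_nth_drop) simp
    also have "drop (Suc i) xs = take (j - Suc i) (drop (Suc i) xs) @ xs ! i # drop (Suc j) xs"
      using id_take_nth_drop[OF ys(2)] ys(1) that by simp
    finally have "xs = take i xs @ xs ! i # take (j - Suc i) (drop (Suc i) xs)
        @ xs ! i # drop (Suc j) xs" .
    from arg_cong[OF this, of f] show ?thesis
      by (rule trans) (rule adj_alternating_distant[OF m a])
  qed
  ultimately show "f \<in> alt_maps sA sB n"
    using r by (simp add: alt_maps_def)
qed

subsection \<open>The Chevalley--Eilenberg differential\<close>

context lie_rep
begin

sublocale bl: Vector_Spaces.linear scale scale "\<lambda>x. bracket x y" for y
  by (rule bracket_linear_left)
sublocale br: Vector_Spaces.linear scale scale "\<lambda>y. bracket x y" for x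
  by (rule bracket_linear_right)
sublocale rl: Vector_Spaces.linear scale scaleV "\<lambda>x. \<rho> x v" for v
  by (rule rho_linear_left)
sublocale rr: Vector_Spaces.linear scaleV scaleV "\<rho> x" for x
  by (rule rho_linear_right)

lemma bracket_anti: "bracket x y = - bracket y x"
proof -
  have "bracket (x + y) (x + y) = bracket x x + bracket y x + (bracket x y + bracket y y)"
    by (simp only: bl.add br.add)
  then have "bracket x y + bracket y x = 0"
    by (simp add: bracket_self add.commute)
  then show ?thesis by (simp add: eq_neg_iff_add_eq_0)
qed

lemma bracket_bracket: "bracket (bracket x y) z = bracket x (bracket y z) - bracket y (bracket x z)"
proof -
  have "bracket y (bracket z x) = - bracket y (bracket x z)"
    by (subst bracket_anti[of z x]) (rule br.neg)
  moreover have "bracket z (bracket x y) = - bracket (bracket x y) z"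
    by (rule bracket_anti)
  ultimately show ?thesis
    using jacobi[of x y z] by simp
qed

text \<open>With \<open>f (y # _)\<close> as the contraction by \<open>y\<close>, the recursions below are the identity
  \<open>[L\<^sub>x, \<iota>\<^sub>y] = \<iota>\<^bsub>[x,y]\<^esub>\<close> and Cartan's formula \<open>\<iota>\<^sub>x d + d \<iota>\<^sub>x = L\<^sub>x\<close>, read as definitions.\<close>

primrec lie_der :: "'g \<Rightarrow> ('g list \<Rightarrow> 'v) \<Rightarrow> 'g list \<Rightarrow> 'v" where
  "lie_der x f [] = \<rho> x (f [])"
| "lie_der x f (y # ys) = lie_der x (\<lambda>zs. f (y # zs)) ys - f (bracket x y # ys)"

primrec cobd :: "('g list \<Rightarrow> 'v) \<Rightarrow> 'g list \<Rightarrow> 'v" where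
  "cobd f [] = 0"
| "cobd f (x # xs) = lie_der x f xs - cobd (\<lambda>ys. f (x # ys)) xs"

section \<open>Linearity, alternation and degree of the Lie derivative and the coboundary\<close>

lemma lie_der_fun_add: "lie_der x (\<lambda>ys. f ys + g ys) xs = lie_der x f xs + lie_der x g xs"
  by (induction xs arbitrary: f g) (simp_all add: rr.add)

lemma lie_der_fun_diff: "lie_der x (\<lambda>ys. f ys - g ys) xs = lie_der x f xs - lie_der x g xs"
  by (induction xs arbitrary: f g) (simp_all add: rr.diff)

lemma lie_der_fun_scale: "lie_der x (\<lambda>ys. scaleV c (f ys)) xs = scaleV c (lie_der x f xs)"
  by (induction xs arbitrary: f) (simp_all add: rr.scale V.scale_right_diff_distrib)

lemma lie_der_fun_zero: "lie_der x (\<lambda>ys. 0) xs = 0"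
  by (induction xs) (simp_all add: rr.zero)

lemma cobd_fun_add: "cobd (\<lambda>ys. f ys + g ys) xs = cobd f xs + cobd g xs"
  by (induction xs arbitrary: f g) (simp_all add: lie_der_fun_add)

lemma cobd_fun_diff: "cobd (\<lambda>ys. f ys - g ys) xs = cobd f xs - cobd g xs"
  by (induction xs arbitrary: f g) (simp_all add: lie_der_fun_diff)

lemma cobd_fun_scale: "cobd (\<lambda>ys. scaleV c (f ys)) xs = scaleV c (cobd f xs)"
  by (induction xs arbitrary: f) (simp_all add: lie_der_fun_scale V.scale_right_diff_distrib)

lemma cobd_fun_zero: "cobd (\<lambda>ys. 0) xs = 0"
  by (induction xs) (simp_all add: lie_der_fun_zero)

lemma lie_der_add:
  "multilinear scale scaleV f \<Longrightarrow> lie_der (x + y) f xs = lie_der x f xs + lie_der y f xs"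
proof (induction xs arbitrary: f)
  case Nil
  show ?case by (simp add: rl.add)
next
  case (Cons z zs)
  show ?case
    using Cons.IH[OF multilinear_contract[OF Cons.prems, of z]]
    by (simp add: bl.add multilinear_Cons_add[OF Cons.prems])
qed

lemma lie_der_scale:
  "multilinear scale scaleV f \<Longrightarrow> lie_der (scale c x) f xs = scaleV c (lie_der x f xs)"
proof (induction xs arbitrary: f)
  case Nil
  show ?case by (simp add: rl.scale)
next
  case (Cons z zs)
  show ?case
    using Cons.IH[OF multilinear_contract[OF Cons.prems, of z]]
    by (simp add: bl.scale multilinear_Cons_scale[OF Cons.prems] V.scale_right_diff_distrib)
qed

lemma multilinear_lie_der:
  assumes "multilinear scale scaleV f"
  shows "multilinear scale scaleV (lie_der x f)"
proof (rule multilinearI)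
  fix ys c a b zs
  show "lie_der x f (ys @ (a + b) # zs) = lie_der x f (ys @ a # zs) + lie_der x f (ys @ b # zs)"
    using assms
  proof (induction ys arbitrary: f)
    case Nil
    show ?case by (simp add: multilinear_Cons_add[OF Nil] lie_der_fun_add br.add)
  next
    case (Cons y ys)
    show ?case
      using Cons.IH[OF multilinear_contract[OF Cons.prems, of y]]
        multilinear_add[OF Cons.prems, of "bracket x y # ys"] by simp
  qed
  show "lie_der x f (ys @ scale c a # zs) = scaleV c (lie_der x f (ys @ a # zs))"
    using assms
  proof (induction ys arbitrary: f)
    case Nil
    show ?case
      by (simp add: multilinear_Cons_scale[OF Nil] lie_der_fun_scale br.scale
          V.scale_right_diff_distrib)
  next
    case (Cons y ys)
    show ?case
      using Cons.IH[OF multilinear_contract[OF Cons.prems, of y]]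
        multilinear_scale[OF Cons.prems, of "bracket x y # ys"]
      by (simp add: V.scale_right_diff_distrib)
  qed
qed

lemma multilinear_cobd:
  assumes "multilinear scale scaleV f"
  shows "multilinear scale scaleV (cobd f)"
proof (rule multilinearI)
  fix ys c a b zs
  show "cobd f (ys @ (a + b) # zs) = cobd f (ys @ a # zs) + cobd f (ys @ b # zs)"
    using assms
  proof (induction ys arbitrary: f)
    case Nil
    show ?case by (simp add: multilinear_Cons_add[OF Nil] lie_der_add[OF Nil] cobd_fun_add)
  next
    case (Cons y ys)
    show ?case
      using Cons.IH[OF multilinear_contract[OF Cons.prems, of y]]
        multilinear_add[OF multilinear_lie_der[OF Cons.prems]] by simp
  qed
  show "cobd f (ys @ scale c a # zs) = scaleV c (cobd f (ys @ a # zs))"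
    using assms
  proof (induction ys arbitrary: f)
    case Nil
    show ?case
      by (simp add: multilinear_Cons_scale[OF Nil] lie_der_scale[OF Nil] cobd_fun_scale
          V.scale_right_diff_distrib)
  next
    case (Cons y ys)
    show ?case
      using Cons.IH[OF multilinear_contract[OF Cons.prems, of y]]
        multilinear_scale[OF multilinear_lie_der[OF Cons.prems]]
      by (simp add: V.scale_right_diff_distrib)
  qed
qed

text \<open>At the repeated pair, the terms with \<open>bracket x a\<close> in the first and in the
  second slot cancel by antisymmetry.\<close>

lemma adj_alternating_lie_der:
  assumes "multilinear scale scaleV f" and "adj_alternating f"
  shows "adj_alternating (lie_der x f)"
  unfolding adj_alternating_def
proof (intro allI)
  fix ys a zs
  show "lie_der x f (ys @ a # a # zs) = 0"
    using assms
  proof (induction ys arbitrary: f)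
    case Nil
    show ?case
      using adj_alternating_Cons_swap[OF Nil, of a "bracket x a" zs]
      by (simp add: adj_alternating_Cons[OF Nil(2)] lie_der_fun_zero)
  next
    case (Cons y ys)
    show ?case
      using adj_alternatingD[OF Cons.prems(2), of "bracket x y # ys" a zs]
        Cons.IH[OF multilinear_contract[OF Cons.prems(1), of y]
          adj_alternating_contract[OF Cons.prems(2), of y]]
      by simp
  qed
qed

text \<open>At the repeated pair, the recursion produces the Lie derivative along \<open>a\<close>
  of the contraction by \<open>a\<close> twice with opposite signs; what remains involves
  \<open>bracket a a\<close> or a double contraction by \<open>a\<close>.\<close>

lemma adj_alternating_cobd:
  assumes "multilinear scale scaleV f" and "adj_alternating f"
  shows "adj_alternating (cobd f)"
  unfolding adj_alternating_def
proof (intro allI)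
  fix ys a zs
  show "cobd f (ys @ a # a # zs) = 0"
    using assms
  proof (induction ys arbitrary: f)
    case Nil
    show ?case
      \<comment> \<open>This instance says \<open>f (0 # zs) = 0\<close>, which disposes of the term
        with \<open>bracket a a\<close>.\<close>
      using multilinear_Cons_diff[OF Nil(1), of 0 0 zs]
      by (simp add: adj_alternating_Cons[OF Nil(2)] cobd_fun_zero bracket_self)
  next
    case (Cons y ys)
    show ?case
      using adj_alternatingD[OF adj_alternating_lie_der[OF Cons.prems]]
        Cons.IH[OF multilinear_contract[OF Cons.prems(1), of y]
          adj_alternating_contract[OF Cons.prems(2), of y]]
      by simp
  qed
qed

lemma lie_der_length:
  "\<forall>xs. length xs \<noteq> n \<longrightarrow> f xs = 0 \<Longrightarrow> length xs \<noteq> n \<Longrightarrow> lie_der x f xs = 0"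
proof (induction xs arbitrary: f n)
  case Nil
  then show ?case by (simp add: rr.zero)
next
  case (Cons y ys)
  then show ?case
  proof (cases n)
    \<comment> \<open>Degree 0 has no predecessor for the induction hypothesis, but here the
      contraction is the zero map.\<close>
    case 0
    have "(\<lambda>zs. f (y # zs)) = (\<lambda>zs. 0)" using Cons.prems 0 by auto
    then show ?thesis using Cons.prems 0 by (simp add: lie_der_fun_zero)
  next
    case (Suc m)
    then show ?thesis using Cons.IH[of m "\<lambda>zs. f (y # zs)"] Cons.prems by simp
  qed
qed

lemma cobd_length:
  "\<forall>xs. length xs \<noteq> n \<longrightarrow> f xs = 0 \<Longrightarrow> length xs \<noteq> Suc n \<Longrightarrow> cobd f xs = 0"
proof (induction xs arbitrary: f n)
  case Nil
  then show ?case by simp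
next
  case (Cons y ys)
  have "cobd (\<lambda>zs. f (y # zs)) ys = 0"
  proof (cases n)
    case 0
    then have "(\<lambda>zs. f (y # zs)) = (\<lambda>zs. 0)" using Cons.prems by auto
    then show ?thesis by (simp add: cobd_fun_zero)
  next
    case (Suc m)
    then show ?thesis using Cons.IH[of m "\<lambda>zs. f (y # zs)"] Cons.prems by simp
  qed
  then show ?case using lie_der_length[OF Cons.prems(1), of ys] Cons.prems(2) by simp
qed

text \<open>After contraction with \<open>z\<close>, the terms where one of \<open>x\<close>,
  \<open>y\<close> acts on \<open>z\<close> and the other on the rest cancel; those where both act
  on \<open>z\<close> combine by the Jacobi identity \<open>bracket_bracket\<close>.\<close>

lemma lie_der_commutator:
  "multilinear scale scaleV f \<Longrightarrow>
    lie_der x (lie_der y f) zs - lie_der y (lie_der x f) zs = lie_der (bracket x y) f zs"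
proof (induction zs arbitrary: f)
  case Nil
  then show ?case by (simp add: rho_bracket)
next
  case (Cons z zs)
  have "lie_der (bracket x y) (\<lambda>zs. f (z # zs)) zs
      = lie_der x (lie_der y (\<lambda>zs. f (z # zs))) zs - lie_der y (lie_der x (\<lambda>zs. f (z # zs))) zs"
    by (rule Cons.IH[symmetric]) (rule multilinear_contract[OF Cons.prems])
  then show ?case
    by (simp add: lie_der_fun_diff bracket_bracket multilinear_Cons_diff[OF Cons.prems])
qed

text \<open>Contracting with \<open>y\<close> leaves the induction hypothesis for the contracted map
  and the commutator relation for \<open>x\<close> and \<open>y\<close>.\<close>

lemma lie_der_cobd:
  "multilinear scale scaleV f \<Longrightarrow> lie_der x (cobd f) ys = cobd (lie_der x f) ys"
proof (induction ys arbitrary: f)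
  case Nil
  then show ?case by (simp add: rr.zero)
next
  case (Cons y ys)
  have "lie_der x (cobd (\<lambda>zs. f (y # zs))) ys = cobd (lie_der x (\<lambda>zs. f (y # zs))) ys"
    by (rule Cons.IH) (rule multilinear_contract[OF Cons.prems])
  then show ?case
    using lie_der_commutator[OF Cons.prems, of x y ys]
    by (simp add: lie_der_fun_diff cobd_fun_diff algebra_simps)
qed

text \<open>Contraction with \<open>x\<close> leaves
  \<open>cobd (cobd (\<lambda>ys. f (x # ys)))\<close>, since the two terms with the Lie derivative
  along \<open>x\<close> cancel by \<open>lie_der_cobd\<close>.\<close>

lemma cobd_cobd: "multilinear scale scaleV f \<Longrightarrow> cobd (cobd f) xs = 0"
proof (induction xs arbitrary: f)
  case Nil
  show ?case by simp
next
  case (Cons x xs)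
  have "cobd (cobd (\<lambda>ys. f (x # ys))) xs = 0"
    by (rule Cons.IH) (rule multilinear_contract[OF Cons.prems])
  then show ?case
    by (simp add: cobd_fun_diff lie_der_cobd[OF Cons.prems])
qed

end

section \<open>Comparison of the recursive coboundary with the explicit alternating sums\<close>

lemma nths_Cons_Compl:
  "nths (x # xs) (- {0}) = xs"
  "nths (x # xs) (- {Suc i}) = x # nths xs (- {i})"
  "nths (x # xs) (- {0, Suc j}) = nths xs (- {j})"
  "nths (x # xs) (- {Suc i, Suc j}) = x # nths xs (- {i, j})"
  by (auto simp: nths_Cons Compl_eq nths_all intro!: arg_cong[of _ _ "nths xs"])

context lie_rep
begin

text \<open>Moving the bracket to the front past \<open>j\<close> arguments contributes the sign \<open>(-1)^j\<close>.\<close>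

lemma lie_der_eq_sum:
  assumes "multilinear scale scaleV f" and "adj_alternating f"
  shows "lie_der x f xs = \<rho> x (f xs)
    - (\<Sum>j<length xs. scaleV ((-1) ^ j) (f (bracket x (xs ! j) # nths xs (- {j}))))"
  using assms
proof (induction xs arbitrary: f)
  case Nil
  show ?case by simp
next
  case (Cons y ys)
  show ?case
    unfolding lie_der.simps
      Cons.IH[OF multilinear_contract[OF Cons.prems(1)] adj_alternating_contract[OF Cons.prems(2)]]
    by (simp add: sum.lessThan_Suc_shift nths_Cons_Compl sum_negf
        adj_alternating_Cons_swap[OF Cons.prems, of y "bracket x z" for z] del: sum.lessThan_Suc)
qed

text \<open>The Lie derivative supplies the terms with \<open>i = 0\<close>. In the others the minus
  sign of the recursion accounts for the index shift in the first sum, and for moving the bracket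
  past \<open>x\<close> in the second, where the shift of both indices leaves the sign
  unchanged.\<close>

lemma cobd_eq_sum:
  assumes "multilinear scale scaleV f" and "adj_alternating f"
  shows "cobd f xs =
    (\<Sum>i<length xs. scaleV ((-1) ^ i) (\<rho> (xs ! i) (f (nths xs (- {i})))))
    + (\<Sum>j<length xs. \<Sum>i<j. scaleV ((-1) ^ (i + j))
        (f (bracket (xs ! i) (xs ! j) # nths xs (- {i, j}))))"
  using assms
proof (induction xs arbitrary: f)
  case Nil
  show ?case by simp
next
  case (Cons x xs)
  show ?case
    unfolding cobd.simps lie_der_eq_sum[OF Cons.prems]
      Cons.IH[OF multilinear_contract[OF Cons.prems(1)] adj_alternating_contract[OF Cons.prems(2)]]
    by (simp add: sum.lessThan_Suc_shift nths_Cons_Compl sum_negf sum_subtractf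
        adj_alternating_Cons_swap[OF Cons.prems, of x "bracket a b" for a b]
        del: sum.lessThan_Suc)
qed

text \<open>The signs of the two sums differ from those in \<open>cobd_eq_sum\<close> by the common
  factor \<open>(-1) ^ Suc n\<close>; on lists of other lengths both sides vanish.\<close>

lemma CE_diff_eq_cobd:
  assumes "f \<in> alt_maps scale scaleV n"
  shows "CE_diff scaleV bracket \<rho> n f = (\<lambda>xs. scaleV ((-1) ^ Suc n) (cobd f xs))"
proof
  fix xs
  have f: "\<forall>xs. length xs \<noteq> n \<longrightarrow> f xs = 0" "multilinear scale scaleV f" "adj_alternating f"
    using assms mem_alt_maps_iff[OF vector_space_axioms V.vector_space_axioms] by blast+
  show "CE_diff scaleV bracket \<rho> n f xs = scaleV ((-1) ^ Suc n) (cobd f xs)"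
  proof (cases "length xs = Suc n")
    case True
    have "scaleV ((-1) ^ (Suc i + n)) v = scaleV ((-1) ^ Suc n) (scaleV ((-1) ^ i) v)"
      "scaleV ((-1) ^ (Suc i + Suc j + n + 1)) v = scaleV ((-1) ^ Suc n) (scaleV ((-1) ^ (i + j)) v)"
      for i j v
      by (simp_all add: power_add mult_ac)
    then show ?thesis
      unfolding CE_diff_def cobd_eq_sum[OF f(2,3)]
      by (simp only: True refl if_True V.scale_right_distrib V.scale_sum_right)
  qed (simp add: CE_diff_def cobd_length[OF f(1)])
qed

lemma CE_diff_alt_maps:
  assumes "f \<in> alt_maps scale scaleV n"
  shows "CE_diff scaleV bracket \<rho> n f \<in> alt_maps scale scaleV (Suc n)"
proof -
  note mem = mem_alt_maps_iff[OF vector_space_axioms V.vector_space_axioms]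
  have f: "\<forall>xs. length xs \<noteq> n \<longrightarrow> f xs = 0" "multilinear scale scaleV f" "adj_alternating f"
    using assms mem by blast+
  have "multilinear scale scaleV (\<lambda>xs. scaleV ((-1) ^ Suc n) (cobd f xs))"
    using multilinear_cobd[OF f(2)]
    by (simp add: multilinear_def V.scale_right_distrib V.scale_left_commute[of _ "_ ^ _"])
  moreover have "adj_alternating (\<lambda>xs. scaleV ((-1) ^ Suc n) (cobd f xs))"
    using adj_alternating_cobd[OF f(2,3)] by (simp add: adj_alternating_def)
  ultimately show ?thesis
    unfolding CE_diff_eq_cobd[OF assms] mem using cobd_length[OF f(1)] by auto
qed

lemma CE_diff_CE_diff:
  assumes "f \<in> alt_maps scale scaleV n"
  shows "CE_diff scaleV bracket \<rho> (Suc n) (CE_diff scaleV bracket \<rho> n f) = 0"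
proof -
  have "multilinear scale scaleV f"
    using assms mem_alt_maps_iff[OF vector_space_axioms V.vector_space_axioms] by blast
  then show ?thesis
    unfolding CE_diff_eq_cobd[OF CE_diff_alt_maps[OF assms]]
    unfolding CE_diff_eq_cobd[OF assms]
    by (simp add: cobd_fun_scale cobd_cobd zero_fun_def del: power_Suc)
qed

end

subsection \<open>Compatibility with the differential operators\<close>

context diff_lie_rep
begin

sublocale dg: Vector_Spaces.linear scale scale d
  by (rule d_linear)
sublocale dv: Vector_Spaces.linear scaleV scaleV dV
  by (rule dV_linear)

text \<open>By the weighted Leibniz rule, \<open>x + scale lam (d x)\<close> depends on
  \<open>x\<close> through an endomorphism of the Lie algebra, and a representation composed with an
  endomorphism is a representation.\<close>

sublocale tw: lie_rep scale bracket scaleV "rho_twist scale lam d \<rho>"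
proof unfold_locales
  fix x y v
  have "bracket (x + scale lam (d x)) (y + scale lam (d y))
      = bracket x y + scale lam (d (bracket x y))"
    by (simp add: d_bracket bl.add br.add bl.scale br.scale scale_right_distrib)
  then show "rho_twist scale lam d \<rho> (bracket x y) v
      = rho_twist scale lam d \<rho> x (rho_twist scale lam d \<rho> y v)
        - rho_twist scale lam d \<rho> y (rho_twist scale lam d \<rho> x v)"
    unfolding rho_twist_def by (metis rho_bracket)
qed (simp_all add: rho_twist_def rl.add rl.scale rr.add rr.scale dg.add dg.scale
    scale_right_distrib V.scale_right_distrib V.scale_left_commute algebra_simps)

lemma twist_lie_der: "tw.lie_der x f xs = lie_der x f xs + scaleV lam (\<rho> (d x) (f xs))"
  by (induction xs arbitrary: f) (simp_all add: rho_twist_def rl.add rl.scale)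

text \<open>Adjoin \<open>\<epsilon>\<close> with \<open>\<epsilon>\<^sup>2 = \<lambda> \<epsilon>\<close>. Then \<open>x + \<epsilon> d x\<close> is a homomorphism of Lie algebras; \<open>rcobd\<close> and
  \<open>dpull\<close> are the \<open>\<epsilon>\<close>-coefficients of the coboundary for \<open>\<rho>(x + \<epsilon> d x)\<close> and of the pullback of
  cochains.\<close>

primrec rcobd :: "('g list \<Rightarrow> 'v) \<Rightarrow> 'g list \<Rightarrow> 'v" where
  "rcobd f [] = 0"
| "rcobd f (x # xs) = \<rho> (d x) (f xs) - rcobd (\<lambda>ys. f (x # ys)) xs"

text \<open>The number \<lambda> itself satisfies \<epsilon>^2 = \<lambda> \<epsilon>, and
  substituting it for \<epsilon> turns the extended coboundary into the twisted one.\<close>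

lemma twist_cobd: "tw.cobd f xs = cobd f xs + scaleV lam (rcobd f xs)"
  by (induction xs arbitrary: f)
    (simp_all add: twist_lie_der V.scale_right_diff_distrib algebra_simps)

text \<open>In \<open>dV_rho\<close> the two terms containing \<open>dV v\<close> add up to
  \<open>rho_twist scale lam d \<rho> x (dV v)\<close>.\<close>

lemma dV_lie_der:
  "dV (lie_der x f xs) = tw.lie_der x (\<lambda>ys. dV (f ys)) xs + \<rho> (d x) (f xs)"
  by (induction xs arbitrary: f)
    (simp_all add: rho_twist_def rl.add rl.scale dV_rho dv.diff algebra_simps)

text \<open>This is the \<epsilon>-coefficient of the statement that composition with 1 + \<epsilon>
  \<open>dV\<close> is a chain map; the \<epsilon>^2 term turns \<open>cobd\<close> into
  \<open>tw.cobd\<close>.\<close>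

lemma dV_cobd: "dV (cobd f xs) = tw.cobd (\<lambda>ys. dV (f ys)) xs + rcobd f xs"
  by (induction xs arbitrary: f) (simp_all add: dV_lie_der dv.diff dv.zero algebra_simps)

primrec dpull :: "('g list \<Rightarrow> 'v) \<Rightarrow> 'g list \<Rightarrow> 'v" where
  "dpull f [] = 0"
| "dpull f (x # xs) = dpull (\<lambda>ys. f (x # ys)) xs + f (d x # xs)
     + scaleV lam (dpull (\<lambda>ys. f (d x # ys)) xs)"

section \<open>The pullback coefficient preserves alternating multilinear maps\<close>

lemma dpull_fun_add: "dpull (\<lambda>ys. f ys + g ys) xs = dpull f xs + dpull g xs"
  by (induction xs arbitrary: f g) (simp_all add: V.scale_right_distrib algebra_simps)

lemma dpull_fun_diff: "dpull (\<lambda>ys. f ys - g ys) xs = dpull f xs - dpull g xs"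
  using dpull_fun_add[of "\<lambda>ys. f ys - g ys" g xs] by (simp add: eq_diff_eq)

lemma dpull_fun_scale: "dpull (\<lambda>ys. scaleV c (f ys)) xs = scaleV c (dpull f xs)"
  by (induction xs arbitrary: f)
    (simp_all add: V.scale_right_distrib V.scale_left_commute[of lam])

lemma dpull_fun_zero: "dpull (\<lambda>ys. 0) xs = 0"
  by (induction xs) simp_all

lemma multilinear_dpull:
  assumes "multilinear scale scaleV f"
  shows "multilinear scale scaleV (dpull f)"
proof (rule multilinearI)
  fix ys c a b zs
  show "dpull f (ys @ (a + b) # zs) = dpull f (ys @ a # zs) + dpull f (ys @ b # zs)"
    using assms
  proof (induction ys arbitrary: f)
    case Nil
    show ?case
      by (simp add: multilinear_Cons_add[OF Nil] dg.add dpull_fun_add V.scale_right_distrib)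
  next
    case (Cons y ys)
    show ?case
      using Cons.IH[OF multilinear_contract[OF Cons.prems, of y]]
        Cons.IH[OF multilinear_contract[OF Cons.prems, of "d y"]]
        multilinear_add[OF Cons.prems, of "d y # ys"]
      by (simp add: V.scale_right_distrib)
  qed
  show "dpull f (ys @ scale c a # zs) = scaleV c (dpull f (ys @ a # zs))"
    using assms
  proof (induction ys arbitrary: f)
    case Nil
    show ?case
      by (simp add: multilinear_Cons_scale[OF Nil] dg.scale dpull_fun_scale V.scale_right_distrib
          V.scale_left_commute[of lam])
  next
    case (Cons y ys)
    show ?case
      using Cons.IH[OF multilinear_contract[OF Cons.prems, of y]]
        Cons.IH[OF multilinear_contract[OF Cons.prems, of "d y"]]
        multilinear_scale[OF Cons.prems, of "d y # ys"]
      by (simp add: V.scale_right_distrib V.scale_left_commute[of lam])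
  qed
qed

text \<open>At the repeated pair, the terms with \<open>d\<close> on exactly one copy of
  \<open>a\<close> cancel by antisymmetry; the others have two equal neighbours.\<close>

lemma adj_alternating_dpull:
  assumes "multilinear scale scaleV f" and "adj_alternating f"
  shows "adj_alternating (dpull f)"
  unfolding adj_alternating_def
proof (intro allI)
  fix ys a zs
  show "dpull f (ys @ a # a # zs) = 0"
    using assms
  proof (induction ys arbitrary: f)
    case Nil
    have swap: "f (d a # a # zs) = - f (a # d a # zs)" for zs
      by (rule adj_alternating_Cons_swap[OF Nil])
    have "dpull (\<lambda>ys. - f (a # d a # ys)) zs = - dpull (\<lambda>ys. f (a # d a # ys)) zs"
      using dpull_fun_diff[of "\<lambda>ys. 0" "\<lambda>ys. f (a # d a # ys)" zs]
      by (simp add: dpull_fun_zero)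
    then show ?case
      by (simp add: adj_alternating_Cons[OF Nil(2)] dpull_fun_zero swap V.scale_right_distrib)
  next
    case (Cons y ys)
    show ?case
      using adj_alternatingD[OF Cons.prems(2), of "d y # ys" a zs]
        Cons.IH[OF multilinear_contract[OF Cons.prems(1), of y]
          adj_alternating_contract[OF Cons.prems(2), of y]]
        Cons.IH[OF multilinear_contract[OF Cons.prems(1), of "d y"]
          adj_alternating_contract[OF Cons.prems(2), of "d y"]]
      by simp
  qed
qed

text \<open>The \<open>\<epsilon>\<close>-coefficient of the naturality of the Lie derivative under \<open>x + \<epsilon> d x\<close>.\<close>

lemma dpull_lie_der:
  "multilinear scale scaleV f \<Longrightarrow>
    dpull (lie_der x f) xs + lie_der (d x) f xs + scaleV lam (dpull (lie_der (d x) f) xs)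
    = tw.lie_der x (dpull f) xs + \<rho> (d x) (f xs)"
proof (induction xs arbitrary: f)
  case Nil
  show ?case by (simp add: tw.rr.zero)
next
  case (Cons y ys)
  \<comment> \<open>These are the two contractions in the recursion of \<open>dpull\<close>. The
    induction hypothesis is solved for \<open>dpull (lie_der x _)\<close> at both, so that it can be
    used for rewriting.\<close>
  define g h where "g = (\<lambda>zs. f (y # zs))" and "h = (\<lambda>zs. f (d y # zs))"
  have "multilinear scale scaleV g" "multilinear scale scaleV h"
    unfolding g_def h_def by (rule multilinear_contract[OF Cons.prems])+
  note IH = this[THEN Cons.IH]
  have g: "dpull (lie_der x g) ys = tw.lie_der x (dpull g) ys + \<rho> (d x) (g ys)
      - lie_der (d x) g ys - scaleV lam (dpull (lie_der (d x) g) ys)"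
    using IH(1) by (simp add: algebra_simps)
  have h: "dpull (lie_der x h) ys = tw.lie_der x (dpull h) ys + \<rho> (d x) (h ys)
      - lie_der (d x) h ys - scaleV lam (dpull (lie_der (d x) h) ys)"
    using IH(2) by (simp add: algebra_simps)
  have [simp]: "f (y # zs) = g zs" "f (d y # zs) = h zs" for zs
    by (simp_all add: g_def h_def)
  \<comment> \<open>The weighted Leibniz rule enters through the first slot of
    \<open>f\<close>.\<close>
  have fd: "f (d (bracket x y) # zs) = f (bracket (d x) y # zs) + f (bracket x (d y) # zs)
      + scaleV lam (f (bracket (d x) (d y) # zs))" for zs
    by (simp add: d_bracket multilinear_Cons_add[OF Cons.prems]
        multilinear_Cons_scale[OF Cons.prems])
  show ?case
    by (simp add: fd dpull_fun_add dpull_fun_diff dpull_fun_scale tw.lie_der_fun_add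
        tw.lie_der_fun_scale twist_lie_der[of x h] g h V.scale_right_distrib
        V.scale_right_diff_distrib)
qed

text \<open>This is the \<epsilon>-coefficient of the statement that pullback along 1 + \<epsilon>
  \<open>d\<close> is a chain map. Its defect \<open>rcobd f\<close> is the same as in
  \<open>dV_cobd\<close>.\<close>

lemma dpull_cobd:
  "multilinear scale scaleV f \<Longrightarrow> dpull (cobd f) xs = tw.cobd (dpull f) xs + rcobd f xs"
proof (induction xs arbitrary: f)
  case Nil
  show ?case by simp
next
  case (Cons x xs)
  have L: "dpull (lie_der x f) xs = tw.lie_der x (dpull f) xs + \<rho> (d x) (f xs)
      - lie_der (d x) f xs - scaleV lam (dpull (lie_der (d x) f) xs)"
    using dpull_lie_der[OF Cons.prems, of x xs] by (simp add: algebra_simps)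
  show ?case
    by (simp add: L dpull_fun_diff tw.cobd_fun_add tw.cobd_fun_scale
        Cons.IH[OF multilinear_contract[OF Cons.prems]]
        twist_cobd[of "\<lambda>ys. f (d x # ys)"] V.scale_right_distrib V.scale_right_diff_distrib)
qed

end

section \<open>The operator \<delta> as a sum over sets of positions\<close>

lemma apply_at_Cons:
  "apply_at d I (x # xs) = (if 0 \<in> I then d x else x) # apply_at d {i. Suc i \<in> I} xs"
proof -
  have "[0..<length (x # xs)] = 0 # map Suc [0..<length xs]"
    by (simp add: upt_conv_Cons map_Suc_upt del: upt_Suc)
  then show ?thesis
    by (simp add: apply_at_def comp_def del: upt_Suc)
qed

lemma apply_at_empty: "apply_at d {} xs = xs"
  by (simp add: apply_at_def map_nth)

text \<open>A set of positions either omits or contains 0, and the rest is a shifted set; this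
  matches the recursion of \<open>dpull\<close> on the head of the list.\<close>

lemma sum_Pow_lessThan_Suc:
  "sum F (Pow {..<Suc n}) = (\<Sum>I\<in>Pow {..<n}. F (Suc ` I) + F (insert 0 (Suc ` I)))"
proof -
  have inj: "inj_on (image Suc) (Pow {..<n})" "inj_on (\<lambda>I. insert 0 (Suc ` I)) (Pow {..<n})"
    by (auto intro!: inj_onI)
  have "Pow {..<Suc n} = image Suc ` Pow {..<n} \<union> (\<lambda>I. insert 0 (Suc ` I)) ` Pow {..<n}"
    by (simp add: lessThan_Suc_eq_insert_0 Pow_insert image_Pow_surj[OF refl, symmetric]
        image_image)
  moreover have "image Suc ` Pow {..<n} \<inter> (\<lambda>I. insert 0 (Suc ` I)) ` Pow {..<n} = {}"
    by auto
  ultimately show ?thesis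
    by (simp add: sum.union_disjoint sum.reindex inj sum.distrib)
qed

context diff_lie_rep
begin

text \<open>Expand the product of the operators 1 + \<epsilon> \<open>d\<close> over all slots: for
  k > 0 the power \<epsilon>^k equals \<lambda>^(k-1) \<epsilon>, while the empty set contributes
  nothing to the \<epsilon>-coefficient.\<close>

lemma dpull_eq_sum:
  "dpull f xs = (\<Sum>I\<in>Pow {..<length xs}.
     if I = {} then 0 else scaleV (lam ^ (card I - 1)) (f (apply_at d I xs)))"
proof (induction xs arbitrary: f)
  case Nil
  show ?case by simp
next
  case (Cons x xs)
  let ?w = "\<lambda>x I. if I = {} then 0 else scaleV (lam ^ (card I - 1)) (f (x # apply_at d I xs))"
  have out: "(if Suc ` I = {} then 0
      else scaleV (lam ^ (card (Suc ` I) - 1)) (f (apply_at d (Suc ` I) (x # xs)))) = ?w x I" for I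
  proof -
    have "{i. Suc i \<in> Suc ` I} = I" by auto
    then show ?thesis by (simp add: apply_at_Cons card_image)
  qed
  \<comment> \<open>Adding position 0 raises the exponent by one, whence the factor
    \<open>lam\<close>; only for \<open>I = {}\<close> is there no earlier weight, which gives the
    separate term.\<close>
  have ins: "scaleV (lam ^ (card (insert 0 (Suc ` I)) - 1))
        (f (apply_at d (insert 0 (Suc ` I)) (x # xs)))
      = (if I = {} then f (d x # xs) else 0) + scaleV lam (?w (d x) I)"
    if "I \<in> Pow {..<length xs}" for I
  proof -
    from that have "finite I" by (auto intro: finite_subset)
    moreover have "{i. Suc i \<in> Suc ` I} = I" by auto
    ultimately show ?thesis
      by (cases "card I") (auto simp: apply_at_Cons apply_at_empty card_image card_insert_disjoint)
  qed
  have "(\<Sum>I\<in>Pow {..<length (x # xs)}.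
        if I = {} then 0 else scaleV (lam ^ (card I - 1)) (f (apply_at d I (x # xs))))
      = (\<Sum>I\<in>Pow {..<length xs}.
          ?w x I + ((if I = {} then f (d x # xs) else 0) + scaleV lam (?w (d x) I)))"
    unfolding list.size(4) add_0_right add_Suc_right sum_Pow_lessThan_Suc out
    by (intro sum.cong refl arg_cong2[of _ _ _ _ plus]) (simp only: ins insert_not_empty if_False)
  also have "\<dots> = dpull f (x # xs)"
    unfolding dpull.simps Cons.IH by (simp add: sum.distrib V.scale_sum_right)
  finally show ?case by simp
qed

lemma diff_delta_eq:
  assumes "f \<in> alt_maps scale scaleV n"
  shows "diff_delta scaleV lam d dV n f = (\<lambda>xs. dpull f xs - dV (f xs))"
proof
  fix xs
  show "diff_delta scaleV lam d dV n f xs = dpull f xs - dV (f xs)"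
  proof (cases "length xs = n")
    case True
    let ?F = "\<lambda>I. if I = {} then 0 else scaleV (lam ^ (card I - 1)) (f (apply_at d I xs))"
    have "(\<Sum>k = 1..n. scaleV (lam ^ (k - 1))
          (\<Sum>I | I \<subseteq> {..<n} \<and> card I = k. f (apply_at d I xs)))
        = (\<Sum>k = 1..n. sum ?F {I \<in> Pow {..<n}. card I = k})"
      by (auto simp: V.scale_sum_right intro!: sum.cong)
    \<comment> \<open>The added index \<open>k = 0\<close> contributes only the empty set, where
      \<open>?F\<close> is 0; then the subsets can be grouped by cardinality.\<close>
    also have "\<dots> = (\<Sum>k = 0..n. sum ?F {I \<in> Pow {..<n}. card I = k})"
      by (rule sum.mono_neutral_left) (auto simp: not_le intro!: sum.neutral dest: finite_subset)
    also have "\<dots> = sum ?F (Pow {..<n})"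
      by (rule sum.group) (auto simp: subset_eq_atLeast0_lessThan_card lessThan_atLeast0)
    finally show ?thesis
      by (simp add: diff_delta_def dpull_eq_sum True)
  next
    case False
    then have "f (apply_at d I xs) = 0" "f xs = 0" for I
      using assms by (simp_all add: alt_maps_def apply_at_def)
    then show ?thesis
      using False by (simp add: diff_delta_def dpull_eq_sum dv.zero sum.neutral)
  qed
qed

lemma diff_delta_alt_maps:
  assumes "f \<in> alt_maps scale scaleV n"
  shows "diff_delta scaleV lam d dV n f \<in> alt_maps scale scaleV n"
proof -
  note mem = mem_alt_maps_iff[OF vector_space_axioms V.vector_space_axioms]
  have f: "\<forall>xs. length xs \<noteq> n \<longrightarrow> f xs = 0" "multilinear scale scaleV f" "adj_alternating f"
    using assms mem by blast+
  have "\<forall>xs. length xs \<noteq> n \<longrightarrow> diff_delta scaleV lam d dV n f xs = 0"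
    by (simp add: diff_delta_def)
  moreover have "multilinear scale scaleV (\<lambda>xs. dpull f xs - dV (f xs))"
    using f(2) multilinear_dpull[OF f(2)]
    by (simp add: multilinear_def dv.add dv.scale V.scale_right_diff_distrib)
  moreover have "adj_alternating (\<lambda>xs. dpull f xs - dV (f xs))"
    using f(3) adj_alternating_dpull[OF f(2,3)] by (simp add: adj_alternating_def dv.zero)
  ultimately show ?thesis
    unfolding mem by (simp add: diff_delta_eq[OF assms])
qed

text \<open>In the difference of \<open>dpull_cobd\<close> and \<open>dV_cobd\<close> the terms
  \<open>rcobd f\<close> cancel. Both differentials carry the same sign
  \<open>(-1) ^ Suc n\<close>.\<close>

lemma diff_delta_CE_diff:
  assumes "f \<in> alt_maps scale scaleV n"
  shows "diff_delta scaleV lam d dV (Suc n) (CE_diff scaleV bracket \<rho> n f)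
    = CE_diff scaleV bracket (rho_twist scale lam d \<rho>) n (diff_delta scaleV lam d dV n f)"
proof -
  have "multilinear scale scaleV f"
    using assms mem_alt_maps_iff[OF vector_space_axioms V.vector_space_axioms] by blast
  then have "dpull (cobd f) xs - dV (cobd f xs) = tw.cobd (\<lambda>xs. dpull f xs - dV (f xs)) xs" for xs
    by (simp add: dpull_cobd dV_cobd tw.cobd_fun_diff)
  then show ?thesis
    unfolding diff_delta_eq[OF CE_diff_alt_maps[OF assms]]
      tw.CE_diff_eq_cobd[OF diff_delta_alt_maps[OF assms]]
    unfolding diff_delta_eq[OF assms] CE_diff_eq_cobd[OF assms]
    by (simp add: dpull_fun_scale dv.scale flip: V.scale_right_diff_distrib del: power_Suc)
qed

end

subsection \<open>The complex\<close>

context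
  fixes sA :: "'k::field \<Rightarrow> 'a::ab_group_add \<Rightarrow> 'a" and sB :: "'k \<Rightarrow> 'b::ab_group_add \<Rightarrow> 'b"
  assumes vsA: "vector_space sA" and vsB: "vector_space sB"
begin

interpretation B: vector_space sB by (rule vsB)

lemma zero_alt_maps: "0 \<in> alt_maps sA sB n"
  by (simp add: mem_alt_maps_iff[OF vsA vsB] multilinear_def adj_alternating_def)

lemma add_alt_maps:
  "f \<in> alt_maps sA sB n \<Longrightarrow> g \<in> alt_maps sA sB n \<Longrightarrow> f + g \<in> alt_maps sA sB n"
  by (simp add: mem_alt_maps_iff[OF vsA vsB] multilinear_def adj_alternating_def
      B.scale_right_distrib)

lemma diff_alt_maps:
  "f \<in> alt_maps sA sB n \<Longrightarrow> g \<in> alt_maps sA sB n \<Longrightarrow> f - g \<in> alt_maps sA sB n"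
  by (simp add: mem_alt_maps_iff[OF vsA vsB] multilinear_def adj_alternating_def
      B.scale_right_diff_distrib)

lemma scale_alt_maps:
  "f \<in> alt_maps sA sB n \<Longrightarrow> (\<lambda>xs. sB a (f xs)) \<in> alt_maps sA sB n"
  by (simp add: mem_alt_maps_iff[OF vsA vsB] multilinear_def adj_alternating_def
      B.scale_right_distrib B.scale_left_commute[of a])

end

lemma vector_space_DL_scale:
  assumes "vector_space sV"
  shows "vector_space (DL_scale sV)"
proof -
  interpret vector_space sV by fact
  show ?thesis
    by unfold_locales
      (auto simp: DL_scale_def fun_eq_iff scale_right_distrib scale_left_distrib)
qed

lemma subspace_DL_cochains:
  assumes "vector_space sG" and "vector_space sV"
  shows "module.subspace (DL_scale sV) (DL_cochains sG sV n)"
proof -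
  interpret D: vector_space "DL_scale sV" by (rule vector_space_DL_scale) fact
  interpret V: vector_space sV by fact
  show ?thesis
    unfolding D.subspace_def
    by (auto simp: DL_cochains_def DL_scale_def zero_prod_def zero_alt_maps[OF assms]
        add_alt_maps[OF assms] scale_alt_maps[OF assms] zero_fun_def[symmetric]
        split: nat.splits)
qed

context lie_rep
begin

lemmas alt_maps_closed =
  zero_alt_maps[OF vector_space_axioms V.vector_space_axioms]
  add_alt_maps[OF vector_space_axioms V.vector_space_axioms]
  diff_alt_maps[OF vector_space_axioms V.vector_space_axioms]
  scale_alt_maps[OF vector_space_axioms V.vector_space_axioms]

lemma CE_diff_add:
  assumes "f \<in> alt_maps scale scaleV n" and "g \<in> alt_maps scale scaleV n"
  shows "CE_diff scaleV bracket \<rho> n (f + g)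
    = CE_diff scaleV bracket \<rho> n f + CE_diff scaleV bracket \<rho> n g"
  unfolding CE_diff_eq_cobd[OF assms(1)] CE_diff_eq_cobd[OF assms(2)]
    CE_diff_eq_cobd[OF alt_maps_closed(2)[OF assms]]
  by (simp add: plus_fun_def cobd_fun_add V.scale_right_distrib del: power_Suc)

lemma CE_diff_minus:
  assumes "f \<in> alt_maps scale scaleV n" and "g \<in> alt_maps scale scaleV n"
  shows "CE_diff scaleV bracket \<rho> n (f - g)
    = CE_diff scaleV bracket \<rho> n f - CE_diff scaleV bracket \<rho> n g"
  unfolding CE_diff_eq_cobd[OF assms(1)] CE_diff_eq_cobd[OF assms(2)]
    CE_diff_eq_cobd[OF alt_maps_closed(3)[OF assms]]
  by (simp add: fun_diff_def cobd_fun_diff V.scale_right_diff_distrib del: power_Suc)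

lemma CE_diff_scale:
  assumes "f \<in> alt_maps scale scaleV n"
  shows "CE_diff scaleV bracket \<rho> n (\<lambda>xs. scaleV a (f xs))
    = (\<lambda>xs. scaleV a (CE_diff scaleV bracket \<rho> n f xs))"
  by (simp add: CE_diff_eq_cobd assms alt_maps_closed cobd_fun_scale mult.commute del: power_Suc)

end

context diff_lie_rep
begin

lemma diff_delta_add:
  assumes "f \<in> alt_maps scale scaleV n" and "g \<in> alt_maps scale scaleV n"
  shows "diff_delta scaleV lam d dV n (f + g)
    = diff_delta scaleV lam d dV n f + diff_delta scaleV lam d dV n g"
  unfolding diff_delta_eq[OF assms(1)] diff_delta_eq[OF assms(2)]
    diff_delta_eq[OF alt_maps_closed(2)[OF assms]]
  by (simp add: plus_fun_def dpull_fun_add dv.add algebra_simps)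

lemma diff_delta_scale:
  assumes "f \<in> alt_maps scale scaleV n"
  shows "diff_delta scaleV lam d dV n (\<lambda>xs. scaleV a (f xs))
    = (\<lambda>xs. scaleV a (diff_delta scaleV lam d dV n f xs))"
  by (simp add: diff_delta_eq assms alt_maps_closed dpull_fun_scale dv.scale
      V.scale_right_diff_distrib)

text \<open>The complex has the shape of a mapping cone of \<delta>: its square vanishes because
  both differentials square to zero and \<delta> is a chain map between them.\<close>

theorem cochain_complex_DL:
  "cochain_complex (DL_scale scaleV) (DL_cochains scale scaleV)
     (DL_diff scale bracket lam d scaleV \<rho> dV)"
  unfolding cochain_complex_def
proof (intro conjI allI ballI)
  let ?C = "DL_cochains scale scaleV" and ?D = "DL_diff scale bracket lam d scaleV \<rho> dV"
  let ?A = "alt_maps scale scaleV" and ?\<delta> = "diff_delta scaleV lam d dV"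
  let ?L = "CE_diff scaleV bracket \<rho>"
    and ?T = "CE_diff scaleV bracket (rho_twist scale lam d \<rho>)"
  show "vector_space (DL_scale scaleV)"
    by (rule vector_space_DL_scale) (rule V.vector_space_axioms)
  fix n
  show "module.subspace (DL_scale scaleV) (?C n)"
    by (rule subspace_DL_cochains) (rule vector_space_axioms V.vector_space_axioms)+
  have neg: "- f \<in> ?A m" if "f \<in> ?A m" for f m
    using alt_maps_closed(3)[OF alt_maps_closed(1) that] by simp
  show "?D n ` ?C n \<subseteq> ?C (Suc n)"
    by (auto simp: DL_cochains_def DL_diff_def CE_diff_alt_maps tw.CE_diff_alt_maps
        diff_delta_alt_maps alt_maps_closed neg split: nat.splits)
  show "linear_on_subspace (?C n) (DL_scale scaleV) (DL_scale scaleV) (?D n)"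
    unfolding linear_on_subspace_def
    by (auto simp: DL_cochains_def DL_diff_def DL_scale_def CE_diff_add tw.CE_diff_add
        CE_diff_scale tw.CE_diff_scale diff_delta_add diff_delta_scale fun_eq_iff
        V.scale_right_diff_distrib split: nat.splits)
  fix c
  assume "c \<in> ?C n"
  then obtain f g where c: "c = (f, g)" and f: "f \<in> ?A n"
    and g: "(f, g) \<in> ?C n"
    by (auto simp: DL_cochains_def)
  note \<delta>f = diff_delta_alt_maps[OF f]
  show "?D (Suc n) (?D n c) = 0"
  proof (cases n)
    case 0
    \<comment> \<open>Compatibility with differences gives \<open>?T n 0 = 0\<close> from equal
      arguments, and then compatibility with negation from the difference with 0.\<close>
    have "?T n (- ?\<delta> n f) = - ?T n (?\<delta> n f)"
      using tw.CE_diff_minus[OF alt_maps_closed(1) \<delta>f] tw.CE_diff_minus[OF \<delta>f \<delta>f] by simp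
    then show ?thesis
      using diff_delta_CE_diff[OF f] CE_diff_CE_diff[OF f]
      by (simp add: c 0 DL_diff_def zero_prod_def)
  next
    case (Suc m)
    with g have g: "g \<in> ?A m" by (simp add: DL_cochains_def)
    note Tg = tw.CE_diff_alt_maps[OF g, folded Suc]
    have "?T n (- ?T m g - ?\<delta> n f) = - ?T n (?T m g) - ?T n (?\<delta> n f)"
      using tw.CE_diff_minus[OF neg[OF Tg] \<delta>f] tw.CE_diff_minus[OF alt_maps_closed(1) Tg]
        tw.CE_diff_minus[OF Tg Tg] by simp
    moreover have "?T n (?T m g) = 0"
      unfolding Suc by (rule tw.CE_diff_CE_diff[OF g])
    ultimately show ?thesis
      using diff_delta_CE_diff[OF f] CE_diff_CE_diff[OF f]
      by (simp add: c Suc DL_diff_def zero_prod_def)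
  qed
qed

subsection \<open>The injection\<close>

text \<open>The summand V is an abelian ideal, so the adjoint action on it factors through the
  projection to the Lie algebra.\<close>

lemma ext_bracket_inr: "ext_bracket bracket \<rho> z (0, v) = (0, \<rho> (fst z) v)"
  by (simp add: ext_bracket_def split_beta br.zero rl.zero)

lemma fst_ext_bracket: "fst (ext_bracket bracket \<rho> z w) = bracket (fst z) (fst w)"
  by (simp add: ext_bracket_def split_beta)

interpretation E: vector_space_prod scale scaleV
  by unfold_locales

lemma prod_scale_inr: "E.scale a (0, v) = (0, scaleV a v)"
  by (simp add: E.scale_def)

lemma hom_inj_alt_maps:
  assumes "f \<in> alt_maps scale scaleV n"
  shows "hom_inj f \<in> alt_maps E.scale E.scale n"
proof -
  have "multilinear scale scaleV f" "adj_alternating f" "\<forall>xs. length xs \<noteq> n \<longrightarrow> f xs = 0"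
    using assms mem_alt_maps_iff[OF vector_space_axioms V.vector_space_axioms] by blast+
  then show ?thesis
    unfolding mem_alt_maps_iff[OF E.p.vector_space_axioms E.p.vector_space_axioms]
    by (simp add: multilinear_def adj_alternating_def hom_inj_def E.scale_def zero_prod_def)
qed

lemma sum_inr: "(\<Sum>i\<in>A. (0, g i)) = (0, \<Sum>i\<in>A. g i)"
  by (simp add: prod_eq_iff fst_sum snd_sum)

text \<open>An arbitrary action \<sigma> that restricts to \<tau> on V covers both the adjoint
  action and its twist. The bracket terms agree because the projection is a homomorphism of Lie
  algebras.\<close>

lemma CE_diff_hom_inj:
  assumes "\<And>z v. \<sigma> z (0, v) = (0, \<tau> (fst z) v)"
  shows "CE_diff E.scale (ext_bracket bracket \<rho>) \<sigma> n (hom_inj f)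
    = hom_inj (CE_diff scaleV bracket \<tau> n f)"
proof
  fix zs
  show "CE_diff E.scale (ext_bracket bracket \<rho>) \<sigma> n (hom_inj f) zs
      = hom_inj (CE_diff scaleV bracket \<tau> n f) zs"
  proof (cases "length zs = Suc n")
    case True
    then show ?thesis
      by (auto simp: CE_diff_def hom_inj_def assms prod_scale_inr sum_inr nths_map
          fst_ext_bracket simp del: sum.lessThan_Suc intro!: arg_cong2[of _ _ _ _ plus] sum.cong)
  qed (simp add: CE_diff_def hom_inj_def zero_prod_def)
qed

lemma ext_d_inr: "ext_d d dV (0, v) = (0, dV v)"
  by (simp add: ext_d_def dg.zero)

lemma map_fst_apply_at: "map fst (apply_at (ext_d d dV) I zs) = apply_at d I (map fst zs)"
  by (simp add: apply_at_def ext_d_def split_beta)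

lemma diff_delta_hom_inj:
  "diff_delta E.scale lam (ext_d d dV) (ext_d d dV) n (hom_inj f)
    = hom_inj (diff_delta scaleV lam d dV n f)"
  by (rule ext)
    (simp add: diff_delta_def hom_inj_def map_fst_apply_at prod_scale_inr sum_inr ext_d_inr
      zero_prod_def)

lemma DL_diff_DL_inj:
  "DL_diff E.scale (ext_bracket bracket \<rho>) lam (ext_d d dV) E.scale (ext_bracket bracket \<rho>)
     (ext_d d dV) n (DL_inj n c)
   = DL_inj (Suc n) (DL_diff scale bracket lam d scaleV \<rho> dV n c)"
proof -
  let ?\<sigma> = "rho_twist E.scale lam (ext_d d dV) (ext_bracket bracket \<rho>)"
    and ?\<tau> = "rho_twist scale lam d \<rho>"
  have "?\<sigma> z (0, v) = (0, ?\<tau> (fst z) v)" for z v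
    by (simp add: rho_twist_def ext_bracket_inr E.scale_def ext_d_def split_beta)
  note CE_diff_hom_inj[of ?\<sigma> ?\<tau>, OF this]
    CE_diff_hom_inj[of "ext_bracket bracket \<rho>" \<rho>, OF ext_bracket_inr]
  then show ?thesis
    by (cases c; cases n)
      (simp_all add: DL_diff_def DL_inj_def diff_delta_hom_inj, simp_all add: hom_inj_def fun_eq_iff)
qed

end

lemma inj_hom_inj: "inj (hom_inj :: ('g list \<Rightarrow> 'v) \<Rightarrow> ('g \<times> 'v) list \<Rightarrow> 'g::zero \<times> 'v)"
proof (rule injI, rule ext)
  fix f g :: "'g list \<Rightarrow> 'v" and xs :: "'g list"
  \<comment> \<open>Any second components serve for this lift of \<open>xs\<close>, since
    \<open>hom_inj\<close> discards them.\<close>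
  let ?zs = "map (\<lambda>x. (x, undefined)) xs"
  assume "hom_inj f = (hom_inj g :: ('g \<times> 'v) list \<Rightarrow> 'g \<times> 'v)"
  then have "hom_inj f ?zs = (hom_inj g ?zs :: 'g \<times> 'v)"
    by simp
  then show "f xs = g xs"
    by (simp add: hom_inj_def comp_def)
qed

theorem proposition5p2:
  fixes scale :: "'k::field_char_0 \<Rightarrow> 'g::ab_group_add \<Rightarrow> 'g"
    and bracket :: "'g \<Rightarrow> 'g \<Rightarrow> 'g" and lam :: 'k and d :: "'g \<Rightarrow> 'g"
    and scaleV :: "'k \<Rightarrow> 'v::ab_group_add \<Rightarrow> 'v" and \<rho> :: "'g \<Rightarrow> 'v \<Rightarrow> 'v" and dV :: "'v \<Rightarrow> 'v"
  assumes "diff_lie_algebra scale bracket lam d"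
    and "diff_lie_rep scale bracket lam d scaleV \<rho> dV"
  defines "scaleE \<equiv> module_prod.scale scale scaleV"
    and "bracketE \<equiv> ext_bracket bracket \<rho>"
    and "dE \<equiv> ext_d d dV"
  shows "subcomplex_via DL_inj
    (DL_scale scaleV) (DL_cochains scale scaleV) (DL_diff scale bracket lam d scaleV \<rho> dV)
    (DL_scale scaleE) (DL_cochains scaleE scaleE) (DL_diff scaleE bracketE lam dE scaleE bracketE dE)"
proof -
  interpret diff_lie_rep scale bracket lam d scaleV \<rho> dV by fact
  interpret E: diff_lie_algebra scaleE bracketE lam dE
    unfolding scaleE_def bracketE_def dE_def by (rule ext_diff_lie_algebra)
  interpret ad: diff_lie_rep scaleE bracketE lam dE scaleE bracketE dE
    by (rule E.adjoint_diff_lie_rep)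
  have scaleE: "scaleE a (0, v) = (0, scaleV a v)" for a v
    unfolding scaleE_def by (rule prod_scale_inr)
  show ?thesis
    unfolding subcomplex_via_def
  proof (intro conjI allI ballI)
    fix n
    \<comment> \<open>Needed in degree 0, where the second component of a cochain must be 0.\<close>
    have "0 = (hom_inj (0 :: 'g list \<Rightarrow> 'v) :: _ \<Rightarrow> 'g \<times> 'v)"
      by (simp add: hom_inj_def fun_eq_iff zero_prod_def)
    then show "DL_inj n ` DL_cochains scale scaleV n \<subseteq> DL_cochains scaleE scaleE n"
      by (auto simp: DL_cochains_def DL_inj_def hom_inj_alt_maps[folded scaleE_def]
          split: nat.splits)
    show "linear_on_subspace (DL_cochains scale scaleV n) (DL_scale scaleV) (DL_scale scaleE)
        (DL_inj n)"
      by (auto simp: linear_on_subspace_def DL_inj_def DL_scale_def hom_inj_def fun_eq_iff scaleE)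
    show "inj_on (DL_inj n) (DL_cochains scale scaleV n)"
      unfolding DL_inj_def
      by (rule inj_on_subset[OF _ subset_UNIV]) (intro prod.inj_map inj_hom_inj)
    show "DL_diff scaleE bracketE lam dE scaleE bracketE dE n (DL_inj n c)
        = DL_inj (Suc n) (DL_diff scale bracket lam d scaleV \<rho> dV n c)" for c
      unfolding scaleE_def bracketE_def dE_def by (rule DL_diff_DL_inj)
  qed (rule cochain_complex_DL ad.cochain_complex_DL)+
qed

end
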